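(* Let $H$ and $K$ be groups, at least one of which is torsion. If $\mathcal P_{\mathrm{fin},1}(H)$ is isomorphic to $\mathcal P_{\mathrm{fin},1}(K)$, then $H$ is isomorphic to $K$.
   Context: For a monoid (in particular, a group) $H$ with identity $1_H$, $\mathcal P_{\mathrm{fin},1}(H)$ (the reduced finitary power monoid of $H$) is the monoid of all finite subsets of $H$ containing $1_H$, with the setwise product $XY = \{xy : x \in X,\, y \in Y\}$ and identity $\{1_H\}$. Isomorphisms are semigroup isomorphisms. A group is torsion if each of its elements $a$ is torsion, i.e. $\{a^n : n \ge 1\}$ is finite. *)

theory Defs
  imports "HOL-Algebra.Coset"
begin

definition fin_power_monoid :: "('a, 'm) monoid_scheme \<Rightarrow> 'a set monoid"
  where "fin_power_monoid H =
    \<lparr>carrier = {X. X \<subseteq> carrier H \<and> finite X \<and> \<one>\<^bsub>H\<^esub> \<in> X},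
     mult = set_mult H,
     one = {\<one>\<^bsub>H\<^esub>}\<rparr>"

definition torsion_group :: "('a, 'm) monoid_scheme \<Rightarrow> bool"
  where "torsion_group H \<longleftrightarrow>
    group H \<and> (\<forall>a \<in> carrier H. finite {a [^]\<^bsub>H\<^esub> n | n :: nat. n \<ge> 1})"

lemma fin_power_monoid_simps [simp]:
  "carrier (fin_power_monoid H) = {X. X \<subseteq> carrier H \<and> finite X \<and> \<one>\<^bsub>H\<^esub> \<in> X}"
  "X \<otimes>\<^bsub>fin_power_monoid H\<^esub> Y = X <#>\<^bsub>H\<^esub> Y"
  "\<one>\<^bsub>fin_power_monoid H\<^esub> = {\<one>\<^bsub>H\<^esub>}"
  by (simp_all add: fin_power_monoid_def)

lemma monoid_fin_power_monoid:
  fixes H (structure)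
  assumes "monoid H"
  shows "monoid (fin_power_monoid H)"
proof -
  interpret monoid H by fact
  show ?thesis
  proof (rule monoidI)
    fix X Y
    assume X: "X \<in> carrier (fin_power_monoid H)" and Y: "Y \<in> carrier (fin_power_monoid H)"
    have "X <#> Y = (\<lambda>(x, y). x \<otimes> y) ` (X \<times> Y)"
      unfolding set_mult_def by auto
    moreover have "\<one> \<in> X <#> Y"
      using X Y unfolding set_mult_def by force
    ultimately show "X \<otimes>\<^bsub>fin_power_monoid H\<^esub> Y \<in> carrier (fin_power_monoid H)"
      using X Y by auto
  next
    fix X Y Z
    assume "X \<in> carrier (fin_power_monoid H)" "Y \<in> carrier (fin_power_monoid H)"
      "Z \<in> carrier (fin_power_monoid H)"
    then have "X \<subseteq> carrier H" "Y \<subseteq> carrier H" "Z \<subseteq> carrier H"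
      by auto
    moreover from this have "(x \<otimes> y) \<otimes> z = x \<otimes> (y \<otimes> z)" if "x \<in> X" "y \<in> Y" "z \<in> Z" for x y z
      using that by (meson m_assoc subsetD)
    ultimately show "X \<otimes>\<^bsub>fin_power_monoid H\<^esub> Y \<otimes>\<^bsub>fin_power_monoid H\<^esub> Z
        = X \<otimes>\<^bsub>fin_power_monoid H\<^esub> (Y \<otimes>\<^bsub>fin_power_monoid H\<^esub> Z)"
      unfolding fin_power_monoid_simps set_mult_def by auto
  next
    fix X
    assume "X \<in> carrier (fin_power_monoid H)"
    then have "X \<subseteq> carrier H"
      by auto
    then have "\<one> \<otimes> x = x" "x \<otimes> \<one> = x" if "x \<in> X" for x
      using that by auto
    then show "\<one>\<^bsub>fin_power_monoid H\<^esub> \<otimes>\<^bsub>fin_power_monoid H\<^esub> X = X"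
      and "X \<otimes>\<^bsub>fin_power_monoid H\<^esub> \<one>\<^bsub>fin_power_monoid H\<^esub> = X"
      by (auto simp: set_mult_def)
  qed auto
qed

end

theory Submission
  imports Defs "HOL-Algebra.Multiplicative_Group"
begin

text \<open>
By symmetry let \<open>H\<close> be the torsion group, and let \<open>f\<close> be an isomorphism from the power monoid of
\<open>H\<close> to that of \<open>K\<close>.  The plan is to show that \<open>f\<close> sends every pair \<open>{1, x}\<close> to a pair \<open>{1, g x}\<close>,
and that the map \<open>g\<close> obtained in this way (called \<open>pullback\<close> below) is an isomorphism of groups.

\<^bold>\<open>Pairs.\<close>  If \<open>L\<close> is idempotent, the sets \<open>X\<close> with \<open>X L = L\<close> are exactly the subsets of \<open>L\<close> that
contain \<open>1\<close>.  So \<open>f\<close> maps the pointed subsets of \<open>L\<close> bijectively to those of \<open>f L\<close>, and \<open>f L\<close> has as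
many elements as \<open>L\<close> (\<open>card_f_idempotent\<close>).  Now let \<open>x \<noteq> 1\<close> have order \<open>n\<close>.  The powers of \<open>{1, x}\<close>
grow strictly until the \<open>(n - 1)\<close>-st one, which is the subgroup generated by \<open>x\<close>; hence the powers
of \<open>f {1, x}\<close> grow strictly for \<open>n - 1\<close> steps and end with a set of \<open>n\<close> elements.  This leaves room for
only two elements in \<open>f {1, x}\<close> (\<open>f_pair\<close>).

\<^bold>\<open>Cyclic subgroups.\<close>  The identity \<open>{1, x}^(k-1) {1, x^k} = {1, x}^(2k-1)\<close> determines \<open>g (x^k)\<close> as
long as \<open>2 k \<le> n\<close>, and inverses take care of the other half of the exponents (\<open>pullback_pow\<close>).

\<^bold>\<open>Products.\<close>  Suppose that neither of \<open>x\<close> and \<open>y\<close> is a power of the other, and write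
\<open>a = g x\<close>, \<open>b = g y\<close>, \<open>c = g (x y)\<close>.  Multiplying the pairs \<open>{1, x y}\<close> and \<open>{1, x}\<close>
by the subgroup generated by \<open>y\<close> gives the same set, so \<open>c = a b^e\<close> for some \<open>e\<close>, and \<open>e = 1\<close> has to be
shown.  If \<open>x^r = y^s\<close>, then \<open>{1, x}^(r-1) {1, x y} {1, y}^s = {1, x}^r {1, y}^(s+1)\<close>
(\<open>grid_relation\<close>).  Applying \<open>f\<close> to this identity, for the least possible \<open>r \<ge> 1\<close>, and comparing the
elements of the coset of \<open>a\<close> yields \<open>e = 1\<close>, provided that the exponents of \<open>y\<close> that occur do not
exhaust the whole cyclic group (\<open>pullback_mult_grid\<close>).  The remaining case is \<open>x^r y^2 = 1\<close>.  There, either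
\<open>r \<ge> 3\<close> and the same argument works for the pair \<open>y^-1, x^-1\<close>, or \<open>r = 2\<close> and the identity
\<open>{1, x} {1, x y} {1, y} = {1, x} {1, x^-1} {1, x y}\<close> decides (\<open>pullback_mult_squares\<close>).

\<^bold>\<open>Surjectivity.\<close>  If \<open>1 \<noteq> x \<in> X\<close> and \<open>L\<close> is the subgroup generated by \<open>x\<close>, then \<open>X L = (X - {x}) L\<close>.  By
induction on the size of \<open>X\<close> this confines \<open>f X\<close> to the range of \<open>g\<close> (\<open>f_subset_range\<close>).  Since \<open>f\<close> is
onto, so is \<open>g\<close>; this also shows that \<open>K\<close> is a torsion group, which is not known beforehand.
\<close>

section \<open>Products of pairs and of powers of pairs\<close>

text \<open>
For \<open>x\<close> in a group this is the \<open>k\<close>-th power of \<open>{1, x}\<close> in the power monoid.  If \<open>x\<close> has finite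
order \<open>n\<close>, it is the subgroup generated by \<open>x\<close> as soon as \<open>k \<ge> n - 1\<close>, and the subgroup generated by
\<open>x\<close> is written \<open>powers_upto G x (ord x - 1)\<close> below.
\<close>

definition powers_upto :: "('a, 'm) monoid_scheme \<Rightarrow> 'a \<Rightarrow> nat \<Rightarrow> 'a set"
  where "powers_upto G x k = (\<lambda>i. x [^]\<^bsub>G\<^esub> i) ` {..k}"

lemma mem_set_mult: "z \<in> A <#>\<^bsub>G\<^esub> B \<longleftrightarrow> (\<exists>a\<in>A. \<exists>b\<in>B. z = a \<otimes>\<^bsub>G\<^esub> b)"
  by (auto simp: set_mult_def)

lemma mem_powers_upto: "z \<in> powers_upto G x k \<longleftrightarrow> (\<exists>i\<le>k. z = x [^]\<^bsub>G\<^esub> i)"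
  by (auto simp: powers_upto_def)

lemma mem_pair_powers:
  "z \<in> {\<one>\<^bsub>G\<^esub>, w} <#>\<^bsub>G\<^esub> powers_upto G y q \<longleftrightarrow>
    (\<exists>j\<le>q. z = \<one>\<^bsub>G\<^esub> \<otimes>\<^bsub>G\<^esub> y [^]\<^bsub>G\<^esub> j \<or> z = w \<otimes>\<^bsub>G\<^esub> y [^]\<^bsub>G\<^esub> j)"
  by (auto simp: set_mult_def powers_upto_def)

lemma mem_powers_pair_powers:
  "z \<in> (powers_upto G x p <#>\<^bsub>G\<^esub> {\<one>\<^bsub>G\<^esub>, w}) <#>\<^bsub>G\<^esub> powers_upto G y q \<longleftrightarrow>
    (\<exists>i\<le>p. \<exists>j\<le>q. z = x [^]\<^bsub>G\<^esub> i \<otimes>\<^bsub>G\<^esub> \<one>\<^bsub>G\<^esub> \<otimes>\<^bsub>G\<^esub> y [^]\<^bsub>G\<^esub> j \<or> z = x [^]\<^bsub>G\<^esub> i \<otimes>\<^bsub>G\<^esub> w \<otimes>\<^bsub>G\<^esub> y [^]\<^bsub>G\<^esub> j)"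
  by (auto simp: set_mult_def powers_upto_def)

lemma mem_powers_powers:
  "z \<in> powers_upto G x p <#>\<^bsub>G\<^esub> powers_upto G y q \<longleftrightarrow>
    (\<exists>i\<le>p. \<exists>j\<le>q. z = x [^]\<^bsub>G\<^esub> i \<otimes>\<^bsub>G\<^esub> y [^]\<^bsub>G\<^esub> j)"
  by (auto simp: set_mult_def powers_upto_def)

lemma card_pointed_subsets:
  assumes "finite L" "e \<in> L"
  shows "card {X. X \<subseteq> L \<and> e \<in> X} = 2 ^ (card L - 1)"
proof -
  have "{X. X \<subseteq> L \<and> e \<in> X} = insert e ` Pow (L - {e})"
  proof (intro equalityI subsetI)
    fix X assume "X \<in> {X. X \<subseteq> L \<and> e \<in> X}"
    then have "X = insert e (X - {e})" "X - {e} \<in> Pow (L - {e})" by auto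
    then show "X \<in> insert e ` Pow (L - {e})" by blast
  qed (use assms in auto)
  moreover have "inj_on (insert e) (Pow (L - {e}))"
    by (auto simp: inj_on_def)
  ultimately show ?thesis
    using assms by (simp add: card_image card_Pow)
qed

text \<open>
Power monoids are in general not groups, so the symmetry of being isomorphic is wanted for monoids.
\<close>

lemma monoid_iso_sym:
  assumes "monoid G" "G \<cong> H"
  shows "H \<cong> G"
proof -
  interpret monoid G by fact
  obtain h where h: "h \<in> hom G H" "bij_betw h (carrier G) (carrier H)"
    using assms(2) unfolding is_iso_def iso_def by blast
  let ?k = "inv_into (carrier G) h"
  have k: "bij_betw ?k (carrier H) (carrier G)"
    by (rule bij_betw_inv_into[OF h(2)])
  have "?k \<in> hom H G"
  proof (rule homI)
    fix x y assume xy: "x \<in> carrier H" "y \<in> carrier H"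
    have kx: "?k x \<in> carrier G" "?k y \<in> carrier G" using k xy by (simp_all add: bij_betw_apply)
    have "h (?k x \<otimes>\<^bsub>G\<^esub> ?k y) = x \<otimes>\<^bsub>H\<^esub> y"
      using hom_mult[OF h(1) kx] bij_betw_inv_into_right[OF h(2)] xy by simp
    then show "?k (x \<otimes>\<^bsub>H\<^esub> y) = ?k x \<otimes>\<^bsub>G\<^esub> ?k y"
      using bij_betw_inv_into_left[OF h(2), of "?k x \<otimes>\<^bsub>G\<^esub> ?k y"] kx by simp
  qed (use k in \<open>simp add: bij_betw_apply\<close>)
  then show ?thesis using k by (intro is_isoI isoI)
qed

lemma torsion_group_ord_pos:
  assumes "torsion_group G" and "x \<in> carrier G"
  shows "0 < group.ord G x"
proof (rule ccontr)
  interpret group G using assms by (simp add: torsion_group_def)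
  assume "\<not> 0 < ord x"
  then have "ord x = 0" by simp
  then have "inj_on (\<lambda>n::nat. x [^]\<^bsub>G\<^esub> n) {1..}"
    by (auto simp: inj_on_def) (metis assms(2) int_pow_eq int_pow_int dvd_0_left_iff eq_iff_diff_eq_0 of_nat_0 of_nat_eq_iff)
  then have "infinite ((\<lambda>n::nat. x [^]\<^bsub>G\<^esub> n) ` {1..})"
    by (simp add: finite_image_iff infinite_Ici)
  moreover have "(\<lambda>n::nat. x [^]\<^bsub>G\<^esub> n) ` {1..} = {x [^]\<^bsub>G\<^esub> n | n :: nat. n \<ge> 1}"
    by auto
  ultimately show False
    using assms by (simp add: torsion_group_def)
qed

context group
begin

lemma pow_eq_iff_mod:
  assumes "x \<in> carrier G"
  shows "x [^] (i::nat) = x [^] (j::nat) \<longleftrightarrow> i mod ord x = j mod ord x"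
proof -
  have "x [^] i = x [^] j \<longleftrightarrow> int (ord x) dvd int j - int i"
    using int_pow_eq[OF assms, of "int i" "int j"] by (simp add: int_pow_int)
  also have "\<dots> \<longleftrightarrow> i mod ord x = j mod ord x"
    by (metis mod_eq_dvd_iff of_nat_eq_iff of_nat_mod)
  finally show ?thesis .
qed

lemma inv_eq_pow:
  assumes "x \<in> carrier G" "0 < ord x"
  shows "inv x = x [^] (ord x - 1)"
proof -
  have "x [^] (ord x - 1) \<otimes> x = \<one>"
    using assms nat_pow_Suc[of x "ord x - 1"] by simp
  then show ?thesis using assms inv_equality by force
qed

lemma pow_mem_powers_upto_ord:
  assumes "x \<in> carrier G" "0 < ord x"
  shows "x [^] (i::nat) \<in> powers_upto G x (ord x - 1)"
proof -
  have "x [^] i = x [^] (i mod ord x)"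
    using assms by (simp add: pow_eq_iff_mod)
  moreover have "i mod ord x \<le> ord x - 1"
    using assms(2) by (metis Suc_pred' less_Suc_eq_le mod_less_divisor)
  ultimately show ?thesis
    by (auto simp: mem_powers_upto)
qed

lemma powers_upto_ord:
  assumes "x \<in> carrier G" "0 < ord x" "ord x - 1 \<le> k"
  shows "powers_upto G x k = powers_upto G x (ord x - 1)"
proof
  show "powers_upto G x k \<subseteq> powers_upto G x (ord x - 1)"
    using assms pow_mem_powers_upto_ord by (auto simp: powers_upto_def)
  show "powers_upto G x (ord x - 1) \<subseteq> powers_upto G x k"
    using assms by (auto simp: powers_upto_def)
qed

lemma powers_upto_in_power_monoid:
  "x \<in> carrier G \<Longrightarrow> powers_upto G x k \<in> carrier (fin_power_monoid G)"
  using image_eqI[of \<one> "\<lambda>i::nat. x [^] i" 0] by (auto simp: powers_upto_def)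

lemma powers_upto_0 [simp]: "powers_upto G x 0 = {\<one>}"
  by (simp add: powers_upto_def)

lemma powers_upto_1: "x \<in> carrier G \<Longrightarrow> powers_upto G x 1 = {\<one>, x}"
  by (auto simp: powers_upto_def atMost_Suc)

lemma powers_upto_mult:
  assumes "x \<in> carrier G"
  shows "powers_upto G x j <#> powers_upto G x k = powers_upto G x (j + k)"
proof (intro equalityI subsetI)
  fix z assume "z \<in> powers_upto G x j <#> powers_upto G x k"
  then obtain i i' where "i \<le> j" "i' \<le> k" "z = x [^] i \<otimes> x [^] i'"
    by (auto simp: mem_set_mult mem_powers_upto)
  then have "i + i' \<le> j + k" "z = x [^] (i + i')"
    using assms by (auto simp: nat_pow_mult)
  then show "z \<in> powers_upto G x (j + k)"
    unfolding mem_powers_upto by blast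
next
  fix z assume "z \<in> powers_upto G x (j + k)"
  then obtain i where i: "i \<le> j + k" "z = x [^] i"
    by (auto simp: mem_powers_upto)
  then have "z = x [^] (min i j) \<otimes> x [^] (i - min i j)"
    using assms by (simp add: nat_pow_mult)
  moreover have "min i j \<le> j" "i - min i j \<le> k" using i by auto
  ultimately show "z \<in> powers_upto G x j <#> powers_upto G x k"
    unfolding mem_set_mult by (metis mem_powers_upto)
qed

lemma powers_upto_neq:
  assumes "x \<in> carrier G" "k < ord x" "j < k"
  shows "powers_upto G x j \<noteq> powers_upto G x k"
proof
  assume "powers_upto G x j = powers_upto G x k"
  then have "x [^] k \<in> powers_upto G x j"
    by (auto simp: mem_powers_upto)
  then obtain i where "i \<le> j" "x [^] k = x [^] i"
    by (auto simp: mem_powers_upto)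
  then show False
    using assms by (simp add: pow_eq_iff_mod)
qed

lemma mult_pair:
  assumes "A \<subseteq> carrier G" "v \<in> carrier G"
  shows "A <#> {\<one>, v} = A \<union> (\<lambda>a. a \<otimes> v) ` A"
proof -
  have "a \<otimes> \<one> = a" if "a \<in> A" for a using that assms(1) by auto
  then show ?thesis by (auto simp: set_mult_def)
qed

lemma powers_upto_mult_pair:
  assumes "x \<in> carrier G"
  shows "powers_upto G x p <#> {\<one>, x [^] (j::nat)} = (\<lambda>i. x [^] i) ` ({..p} \<union> {j..j + p})"
proof -
  have "powers_upto G x p <#> {\<one>, x [^] j}
      = (\<lambda>i. x [^] i) ` {..p} \<union> (\<lambda>i. x [^] (i + j)) ` {..p}"
    using assms unfolding powers_upto_def set_mult_def by (auto simp: nat_pow_mult)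
  also have "(\<lambda>i. x [^] (i + j)) ` {..p} = (\<lambda>i. x [^] i) ` ((\<lambda>i. i + j) ` {..p})"
    by (simp add: image_image)
  also have "(\<lambda>i. i + j) ` {..p} = {j..j + p}"
    using image_add_atLeastAtMost'[of j 0 p] by (simp add: atLeast0AtMost add.commute)
  finally show ?thesis by (simp add: image_Un)
qed

text \<open>
Think of \<open>x^i y^j\<close> as the point \<open>(i, j)\<close> of a grid.  The left-hand side is the rectangle
\<open>[0, p] \<times> [0, s]\<close> together with its translate by \<open>(1, 1)\<close>, and the right-hand side is the rectangle
\<open>[0, p + 1] \<times> [0, s + 1]\<close>.  Only the two corners \<open>(p + 1, 0)\<close> and \<open>(0, s + 1)\<close> are missing on the left.
The relation \<open>x^(p+1) = y^s\<close> identifies them with \<open>(0, s)\<close> and \<open>(p + 1, 1)\<close>, which are present.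
\<close>

lemma grid_relation:
  assumes x: "x \<in> carrier G" and y: "y \<in> carrier G"
    and rel: "x [^] Suc p = y [^] (s::nat)"
  shows "(powers_upto G x p <#> {\<one>, x \<otimes> y}) <#> powers_upto G y s
    = powers_upto G x (Suc p) <#> powers_upto G y (Suc s)" (is "?L = ?R")
proof -
  have step: "x [^] i \<otimes> (x \<otimes> y) \<otimes> y [^] j = x [^] Suc i \<otimes> y [^] Suc j" for i j :: nat
    using x y nat_pow_Suc2[of y j] by (simp add: m_assoc)
  have one: "x [^] i \<otimes> \<one> = x [^] i" for i :: nat using x by simp
  show ?thesis
  proof (intro equalityI subsetI)
    fix z assume "z \<in> ?L"
    then obtain i j where "i \<le> p" "j \<le> s"
      "z = x [^] i \<otimes> y [^] j \<or> z = x [^] Suc i \<otimes> y [^] Suc j"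
      unfolding mem_powers_pair_powers step one by blast
    moreover from this have "i \<le> Suc p" "j \<le> Suc s" "Suc i \<le> Suc p" "Suc j \<le> Suc s" by simp_all
    ultimately show "z \<in> ?R" unfolding mem_powers_powers by blast
  next
    fix z assume "z \<in> ?R"
    then obtain i j where ij: "i \<le> Suc p" "j \<le> Suc s" "z = x [^] i \<otimes> y [^] j"
      unfolding mem_powers_powers by blast
    consider "i \<le> p" "j \<le> s" | i' j' where "i = Suc i'" "j = Suc j'" | "i = Suc p" "j = 0" | "i = 0" "j = Suc s"
      using ij by (cases i; cases j) (auto simp: le_Suc_eq)
    then have "(\<exists>i\<le>p. \<exists>j\<le>s. z = x [^] i \<otimes> y [^] j \<or> z = x [^] Suc i \<otimes> y [^] Suc j)"
    proof cases
      case 1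
      then show ?thesis using ij(3) by blast
    next
      case (2 i' j')
      then have "i' \<le> p" "j' \<le> s" using ij by auto
      then show ?thesis using ij(3) 2 by blast
    next
      case 3
      then have "z = x [^] (0::nat) \<otimes> y [^] s"
        using ij(3) rel x y by simp
      then show ?thesis by blast
    next
      case 4
      then have "z = y [^] s \<otimes> y" using ij(3) y by simp
      also have "\<dots> = x [^] Suc p \<otimes> y [^] Suc 0" using rel y by simp
      finally show ?thesis by blast
    qed
    then show "z \<in> ?L" unfolding mem_powers_pair_powers step one .
  qed
qed

text \<open>
Containment in an idempotent set is thereby expressed by multiplication alone, so that every
isomorphism of power monoids respects it.
\<close>

lemma absorb_iff_subset:
  assumes "L \<subseteq> carrier G" "L <#> L = L" "X \<in> carrier (fin_power_monoid G)" "\<one> \<in> L"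
  shows "X <#> L = L \<longleftrightarrow> X \<subseteq> L"
proof
  assume eq: "X <#> L = L"
  show "X \<subseteq> L"
  proof
    fix x assume "x \<in> X"
    then have "x \<otimes> \<one> \<in> X <#> L" using assms by (auto simp: mem_set_mult)
    then show "x \<in> L" using eq \<open>x \<in> X\<close> assms by auto
  qed
next
  assume sub: "X \<subseteq> L"
  then have "X <#> L \<subseteq> L <#> L" by (auto simp: set_mult_def)
  moreover have "L \<subseteq> X <#> L"
  proof
    fix y assume "y \<in> L"
    then have "y = \<one> \<otimes> y" using assms by auto
    then show "y \<in> X <#> L" using assms \<open>y \<in> L\<close> by (auto simp: mem_set_mult)
  qed
  ultimately show "X <#> L = L" using assms by auto
qed

end

section \<open>Pairs are mapped to pairs\<close>

locale torsion_power_monoid_iso = H: group H + K: group K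
  for H :: "('a, 'm) monoid_scheme" (structure) and K :: "('b, 'n) monoid_scheme" +
  fixes f :: "'a set \<Rightarrow> 'b set"
  assumes f_iso: "f \<in> iso (fin_power_monoid H) (fin_power_monoid K)"
    and ord_pos: "x \<in> carrier H \<Longrightarrow> 0 < H.ord x"
begin

abbreviation PH where "PH \<equiv> carrier (fin_power_monoid H)"
abbreviation PK where "PK \<equiv> carrier (fin_power_monoid K)"

lemma f_bij: "bij_betw f PH PK"
  using f_iso by (simp only: iso_def mem_Collect_eq)

lemma f_closed: "X \<in> PH \<Longrightarrow> f X \<in> PK"
  by (rule bij_betw_apply[OF f_bij])

lemma f_inj: "X \<in> PH \<Longrightarrow> Y \<in> PH \<Longrightarrow> f X = f Y \<Longrightarrow> X = Y"
  by (rule inj_onD[OF bij_betw_imp_inj_on[OF f_bij]])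

lemma f_surj: "Y \<in> PK \<Longrightarrow> \<exists>X\<in>PH. f X = Y"
  unfolding bij_betw_imp_surj_on[OF f_bij, symmetric] by (erule imageE) (rule bexI, simp_all only:)

lemma PH_mult: "X \<in> PH \<Longrightarrow> Y \<in> PH \<Longrightarrow> X <#> Y \<in> PH"
  using monoid.m_closed[OF monoid_fin_power_monoid[OF H.is_monoid]]
  unfolding fin_power_monoid_simps(2) .

lemma f_mult: "X \<in> PH \<Longrightarrow> Y \<in> PH \<Longrightarrow> f (X <#> Y) = f X <#>\<^bsub>K\<^esub> f Y"
  using f_iso hom_mult[of f "fin_power_monoid H" "fin_power_monoid K" X Y]
  unfolding iso_def fin_power_monoid_simps(2) by blast

lemma f_one: "f {\<one>} = {\<one>\<^bsub>K\<^esub>}"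
proof -
  obtain E where E: "E \<in> PH" "f E = {\<one>\<^bsub>K\<^esub>}"
    using f_surj[of "{\<one>\<^bsub>K\<^esub>}"] by auto
  have one: "{\<one>} \<in> PH" by simp
  have "{\<one>} <#> E = E"
    using E monoid.l_one[OF monoid_fin_power_monoid[OF H.is_monoid] E(1)] by simp
  then have "f {\<one>} <#>\<^bsub>K\<^esub> {\<one>\<^bsub>K\<^esub>} = {\<one>\<^bsub>K\<^esub>}"
    using f_mult[OF one E(1)] E(2) by simp
  moreover have "f {\<one>} <#>\<^bsub>K\<^esub> {\<one>\<^bsub>K\<^esub>} = f {\<one>}"
    using monoid.r_one[OF monoid_fin_power_monoid[OF K.is_monoid] f_closed[OF one]] by simp
  ultimately show ?thesis by simp
qed

text \<open>
By \<open>absorb_iff_subset\<close>, \<open>f\<close> restricts to a bijection between the subsets of \<open>L\<close> and of \<open>f L\<close> that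
contain the identity.  A finite set with \<open>m\<close> elements has \<open>2 ^ (m - 1)\<close> pointed subsets, so \<open>L\<close> and
\<open>f L\<close> have the same size.
\<close>

lemma card_f_idempotent:
  assumes "L \<in> PH" "L <#> L = L"
  shows "card (f L) = card L"
proof -
  let ?M = "f L"
  have M: "?M \<in> PK" "?M <#>\<^bsub>K\<^esub> ?M = ?M"
    using assms f_closed f_mult[OF assms(1,1)] by auto
  have L1: "L \<subseteq> carrier H" "\<one> \<in> L" "finite L" using assms by auto
  have M1: "?M \<subseteq> carrier K" "\<one>\<^bsub>K\<^esub> \<in> ?M" "finite ?M" using M by auto
  have iff: "f X \<subseteq> ?M \<longleftrightarrow> X \<subseteq> L" if X: "X \<in> PH" for X
  proof -
    have "f X \<subseteq> ?M \<longleftrightarrow> f X <#>\<^bsub>K\<^esub> ?M = ?M"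
      using K.absorb_iff_subset[OF M1(1) M(2) f_closed[OF X] M1(2)] by simp
    also have "\<dots> \<longleftrightarrow> X <#> L = L"
      using f_mult[OF X assms(1)] f_inj[OF PH_mult[OF X assms(1)] assms(1)] by auto
    also have "\<dots> \<longleftrightarrow> X \<subseteq> L"
      using H.absorb_iff_subset[OF L1(1) assms(2) X L1(2)] .
    finally show ?thesis .
  qed
  have "bij_betw f {X. X \<subseteq> L \<and> \<one> \<in> X} {Y. Y \<subseteq> ?M \<and> \<one>\<^bsub>K\<^esub> \<in> Y}"
  proof (rule bij_betw_imageI)
    have sub: "{X. X \<subseteq> L \<and> \<one> \<in> X} \<subseteq> PH"
      using L1 by (auto intro: finite_subset)
    then show "inj_on f {X. X \<subseteq> L \<and> \<one> \<in> X}"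
      by (meson f_inj inj_on_def subsetD)
    show "f ` {X. X \<subseteq> L \<and> \<one> \<in> X} = {Y. Y \<subseteq> ?M \<and> \<one>\<^bsub>K\<^esub> \<in> Y}"
    proof (intro equalityI subsetI)
      fix Y assume "Y \<in> f ` {X. X \<subseteq> L \<and> \<one> \<in> X}"
      then obtain X where "X \<in> PH" "X \<subseteq> L" "Y = f X" using sub by blast
      then show "Y \<in> {Y. Y \<subseteq> ?M \<and> \<one>\<^bsub>K\<^esub> \<in> Y}"
        using iff f_closed[of X] by auto
    next
      fix Y assume Y: "Y \<in> {Y. Y \<subseteq> ?M \<and> \<one>\<^bsub>K\<^esub> \<in> Y}"
      then have "Y \<in> PK" using M1 by (auto intro: finite_subset)
      then obtain X where X: "X \<in> PH" "f X = Y" using f_surj by blast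
      then show "Y \<in> f ` {X. X \<subseteq> L \<and> \<one> \<in> X}"
        using iff Y by auto
    qed
  qed
  then have "2 ^ (card L - 1) = (2::nat) ^ (card ?M - 1)"
    using bij_betw_same_card card_pointed_subsets[OF L1(3,2)] card_pointed_subsets[OF M1(3,2)]
    by metis
  then have "card L - 1 = card ?M - 1" by simp
  moreover have "card L \<noteq> 0" "card ?M \<noteq> 0" using L1 M1 by auto
  ultimately show ?thesis by simp
qed

text \<open>
Let \<open>x\<close> have order \<open>n \<ge> 2\<close>, and let \<open>Y k\<close> be the \<open>k\<close>-th power of \<open>f {1, x}\<close>.  By injectivity of \<open>f\<close>,
the chain \<open>Y 1 \<subseteq> \<dots> \<subseteq> Y (n - 1)\<close> is strict, and \<open>Y (n - 1)\<close> has \<open>n\<close> elements because it is the image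
of an idempotent with \<open>n\<close> elements.  Therefore \<open>card (Y 1) + (n - 2) \<le> n\<close>.
\<close>

lemma f_pair:
  assumes x: "x \<in> carrier H"
  obtains a where "a \<in> carrier K" "f {\<one>, x} = {\<one>\<^bsub>K\<^esub>, a}" "K.ord a = H.ord x"
proof (cases "x = \<one>")
  case True
  then show ?thesis using that[of "\<one>\<^bsub>K\<^esub>"] f_one by simp
next
  case False
  define n where "n = H.ord x"
  define P where "P = powers_upto H x"
  define Y where "Y k = f (P k)" for k
  have P: "P k \<in> PH" for k
    using H.powers_upto_in_power_monoid[OF x] by (simp add: P_def)
  have Y: "finite (Y k)" "\<one>\<^bsub>K\<^esub> \<in> Y k" "Y k \<subseteq> carrier K" for k
    using f_closed[OF P[of k]] by (auto simp: Y_def)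
  have YSuc: "Y (Suc k) = Y k <#>\<^bsub>K\<^esub> Y 1" for k
    using f_mult[OF P P, of k 1] H.powers_upto_mult[OF x, of k 1]
    by (simp add: Y_def P_def)
  have n: "2 \<le> n"
    using False ord_pos[OF x] H.ord_eq_1[OF x] by (auto simp: n_def)
  have Y_mono: "Y k \<subseteq> Y (Suc k)" for k
  proof
    fix z assume z: "z \<in> Y k"
    then have "z = z \<otimes>\<^bsub>K\<^esub> \<one>\<^bsub>K\<^esub>" using Y(3) K.r_one by (metis subsetD)
    then show "z \<in> Y (Suc k)" unfolding YSuc mem_set_mult using z Y by blast
  qed
  have strict: "card (Y k) < card (Y (Suc k))" if "Suc k < n" for k
  proof (rule psubset_card_mono[OF Y(1)], rule psubsetI[OF Y_mono])
    show "Y k \<noteq> Y (Suc k)"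
      using f_inj[OF P P, of k "Suc k"] H.powers_upto_neq[OF x, of "Suc k" k] that
      by (auto simp: Y_def P_def n_def)
  qed
  have lower: "Suc k < n \<Longrightarrow> card (Y 1) + k \<le> card (Y (Suc k))" for k
  proof (induction k)
    case (Suc k)
    then show ?case using strict[of "Suc k"] by simp
  qed simp
  have "card (Y (n - 1)) = card (P (n - 1))"
    unfolding Y_def
  proof (rule card_f_idempotent[OF P])
    show "P (n - 1) <#> P (n - 1) = P (n - 1)"
      using H.powers_upto_mult[OF x, of "n - 1" "n - 1"]
        H.powers_upto_ord[OF x ord_pos[OF x], of "n - 1 + (n - 1)"]
      by (simp add: P_def n_def)
  qed
  also have "\<dots> = n"
  proof -
    have "inj_on (\<lambda>i. x [^] i) {..n - 1}"
      using n by (auto simp: inj_on_def H.pow_eq_iff_mod[OF x] n_def)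
    then show ?thesis using n by (simp add: P_def powers_upto_def card_image)
  qed
  finally have top: "card (Y (n - 1)) = n" .
  have "card (Y 1) \<le> 2"
    using lower[of "n - 2"] top n by (simp add: numeral_2_eq_2 Suc_diff_Suc)
  moreover have Y0: "Y 0 = {\<one>\<^bsub>K\<^esub>}"
    using f_one by (simp add: Y_def P_def)
  moreover have "card (Y 0) < card (Y 1)"
    using strict[of 0] n by simp
  ultimately have "card (Y 1 - {\<one>\<^bsub>K\<^esub>}) = 1"
    using Y by simp
  then obtain a where "Y 1 - {\<one>\<^bsub>K\<^esub>} = {a}" by (auto simp: card_1_singleton_iff)
  then have Y1: "Y 1 = {\<one>\<^bsub>K\<^esub>, a}" and a: "a \<in> carrier K"
    using Y[of 1] by auto
  have Yk: "Y k = powers_upto K a k" for k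
  proof (induction k)
    case (Suc k)
    have "Y (Suc k) = powers_upto K a k <#>\<^bsub>K\<^esub> powers_upto K a 1"
      by (simp only: YSuc[of k] Suc Y1 K.powers_upto_1[OF a])
    then show ?case
      using K.powers_upto_mult[OF a, of k 1] by simp
  qed (simp add: Y0)
  \<comment> \<open>The first \<open>n\<close> powers of \<open>a\<close> are distinct and the next one repeats one of them.\<close>
  have "inj_on (\<lambda>i. a [^]\<^bsub>K\<^esub> i) {..n - 1}"
    using top n unfolding Yk powers_upto_def by (intro eq_card_imp_inj_on) auto
  then have ge: "n \<le> K.ord a \<or> K.ord a = 0"
    using K.pow_ord_eq_1[OF a] n by (fastforce dest: inj_onD[where x = "K.ord a" and y = 0])
  have "Y n = Y (n - 1)"
    using H.powers_upto_ord[OF x ord_pos[OF x], of n] by (simp add: Y_def P_def n_def)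
  moreover have "a [^]\<^bsub>K\<^esub> n \<in> Y n"
    unfolding Yk mem_powers_upto by blast
  ultimately have "a [^]\<^bsub>K\<^esub> n \<in> powers_upto K a (n - 1)"
    unfolding Yk by simp
  then obtain i where i: "i \<le> n - 1" "a [^]\<^bsub>K\<^esub> n = a [^]\<^bsub>K\<^esub> i"
    by (auto simp: mem_powers_upto)
  then have eqm: "n mod K.ord a = i mod K.ord a" using K.pow_eq_iff_mod[OF a] by simp
  have "K.ord a = n"
  proof (rule ccontr)
    assume "K.ord a \<noteq> n"
    then have "n mod K.ord a = n" "i mod K.ord a = i" using ge i by auto
    then show False using eqm i(1) n by linarith
  qed
  moreover have "f {\<one>, x} = Y 1"
    using H.powers_upto_1[OF x] by (simp add: Y_def P_def)
  ultimately show ?thesis using that[OF a] Y1 by (simp add: n_def)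
qed

section \<open>The induced map on cyclic subgroups\<close>

definition pullback :: "'a \<Rightarrow> 'b"
  where "pullback x = (THE a. f {\<one>, x} = {\<one>\<^bsub>K\<^esub>, a})"

lemma
  assumes x: "x \<in> carrier H"
  shows pullback_closed [simp]: "pullback x \<in> carrier K"
    and f_pair_pullback: "f {\<one>, x} = {\<one>\<^bsub>K\<^esub>, pullback x}"
    and ord_pullback [simp]: "K.ord (pullback x) = H.ord x"
proof -
  obtain a where a: "a \<in> carrier K" "f {\<one>, x} = {\<one>\<^bsub>K\<^esub>, a}" "K.ord a = H.ord x"
    using f_pair[OF x] .
  have "pullback x = a"
    unfolding pullback_def a(2) by (rule the_equality) (auto simp: doubleton_eq_iff)
  then show "pullback x \<in> carrier K" "f {\<one>, x} = {\<one>\<^bsub>K\<^esub>, pullback x}"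
    "K.ord (pullback x) = H.ord x"
    using a by simp_all
qed

lemma pair_in_PH: "x \<in> carrier H \<Longrightarrow> {\<one>, x} \<in> PH"
  by simp

lemma pullback_inj:
  assumes "x \<in> carrier H" "y \<in> carrier H" "pullback x = pullback y"
  shows "x = y"
proof -
  have "{\<one>, x} = {\<one>, y}"
    using assms f_pair_pullback by (intro f_inj pair_in_PH) simp_all
  then show ?thesis by (auto simp: doubleton_eq_iff)
qed

lemma pullback_one [simp]: "pullback \<one> = \<one>\<^bsub>K\<^esub>"
proof -
  have "{\<one>\<^bsub>K\<^esub>, pullback \<one>} = {\<one>\<^bsub>K\<^esub>}"
    using f_pair_pullback[of \<one>] f_one by simp
  then show ?thesis by blast
qed

lemma powers_in_PH: "x \<in> carrier H \<Longrightarrow> powers_upto H x k \<in> PH"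
  by (rule H.powers_upto_in_power_monoid)

lemma f_powers_upto:
  assumes x: "x \<in> carrier H"
  shows "f (powers_upto H x k) = powers_upto K (pullback x) k"
proof (induction k)
  case 0
  then show ?case by (simp add: f_one)
next
  case (Suc k)
  have "powers_upto H x (Suc k) = powers_upto H x k <#> {\<one>, x}"
    using H.powers_upto_mult[OF x, of k 1] H.powers_upto_1[OF x] by simp
  then have "f (powers_upto H x (Suc k)) = powers_upto K (pullback x) k <#>\<^bsub>K\<^esub> {\<one>\<^bsub>K\<^esub>, pullback x}"
    by (simp only: f_mult[OF powers_in_PH[OF x] pair_in_PH[OF x]] Suc f_pair_pullback[OF x])
  also have "\<dots> = powers_upto K (pullback x) (Suc k)"
    using K.powers_upto_mult[OF pullback_closed[OF x], of k 1]
      K.powers_upto_1[OF pullback_closed[OF x]] by simp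
  finally show ?case .
qed

lemma K_pow_eq_iff:
  assumes "x \<in> carrier H"
  shows "pullback x [^]\<^bsub>K\<^esub> (i::nat) = pullback x [^]\<^bsub>K\<^esub> (j::nat) \<longleftrightarrow> i mod H.ord x = j mod H.ord x"
  using K.pow_eq_iff_mod[OF pullback_closed[OF assms]] assms by simp

lemma cyclic_insert_mult:
  assumes "x \<in> carrier H"
  shows "{\<one>, x [^] (j::nat)} <#> powers_upto H x (H.ord x - 1) = powers_upto H x (H.ord x - 1)"
proof (rule iffD2[OF H.absorb_iff_subset])
  let ?L = "powers_upto H x (H.ord x - 1)"
  show "?L \<subseteq> carrier H" "\<one> \<in> ?L" using powers_in_PH[OF assms] by auto
  show "?L <#> ?L = ?L"
    using H.powers_upto_mult[OF assms]
      H.powers_upto_ord[OF assms ord_pos[OF assms], of "H.ord x - 1 + (H.ord x - 1)"] by simp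
  show "{\<one>, x [^] j} \<in> PH" using assms by simp
  show "{\<one>, x [^] j} \<subseteq> ?L"
    using \<open>\<one> \<in> ?L\<close> H.pow_mem_powers_upto_ord[OF assms ord_pos[OF assms]] by simp
qed

text \<open>
A pair \<open>{1, z}\<close> is absorbed by the subgroup generated by \<open>x\<close> when \<open>z\<close> is a power of \<open>x\<close>, and this
property is carried over by \<open>f\<close>.
\<close>

lemma pullback_pow_mem:
  assumes x: "x \<in> carrier H"
  obtains j where "j < H.ord x" "pullback (x [^] (k::nat)) = pullback x [^]\<^bsub>K\<^esub> (j::nat)"
proof -
  let ?n = "H.ord x" and ?a = "pullback x"
  have xk: "x [^] k \<in> carrier H" using x by simp
  have "{\<one>\<^bsub>K\<^esub>, pullback (x [^] k)} <#>\<^bsub>K\<^esub> powers_upto K ?a (?n - 1) = powers_upto K ?a (?n - 1)"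
    using f_mult[OF pair_in_PH[OF xk] powers_in_PH[OF x, of "?n - 1"]]
    unfolding cyclic_insert_mult[OF x] f_pair_pullback[OF xk] f_powers_upto[OF x] by simp
  moreover have "pullback (x [^] k) \<otimes>\<^bsub>K\<^esub> \<one>\<^bsub>K\<^esub>
      \<in> {\<one>\<^bsub>K\<^esub>, pullback (x [^] k)} <#>\<^bsub>K\<^esub> powers_upto K ?a (?n - 1)"
    using K.powers_upto_in_power_monoid[OF pullback_closed[OF x]] by (auto simp: mem_set_mult)
  ultimately have "pullback (x [^] k) \<in> powers_upto K ?a (?n - 1)"
    using xk by simp
  then obtain j where "j \<le> ?n - 1" "pullback (x [^] k) = ?a [^]\<^bsub>K\<^esub> j"
    by (auto simp: mem_powers_upto)
  then show ?thesis using that[of j] ord_pos[OF x] by simp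
qed

text \<open>
Write \<open>g (x^k) = a^j\<close> with \<open>a = g x\<close>.  Applying \<open>f\<close> to \<open>{1, x}^(k-1) {1, x^k} = {1, x}^(2k-1)\<close> shows
that the exponent intervals \<open>[0, k - 1]\<close> and \<open>[j, j + k - 1]\<close> together cover \<open>[0, 2 k - 1]\<close> modulo \<open>n\<close>.
As \<open>2 k \<le> n\<close>, the second interval must be \<open>[k, 2 k - 1]\<close>.
\<close>

lemma pullback_pow_small:
  assumes x: "x \<in> carrier H" and k: "1 \<le> k" "2 * k \<le> H.ord x"
  shows "pullback (x [^] (k::nat)) = pullback x [^]\<^bsub>K\<^esub> k"
proof -
  let ?n = "H.ord x" and ?a = "pullback x"
  have xk: "x [^] k \<in> carrier H" using x by simp
  obtain j where j: "j < ?n" "pullback (x [^] k) = ?a [^]\<^bsub>K\<^esub> j"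
    using pullback_pow_mem[OF x] .
  have "{..k - 1} \<union> {k..k + (k - 1)} = {..2 * k - 1}"
    using k(1) by auto
  then have "powers_upto H x (k - 1) <#> {\<one>, x [^] k} = powers_upto H x (2 * k - 1)"
    unfolding H.powers_upto_mult_pair[OF x] by (simp add: powers_upto_def)
  then have "powers_upto K ?a (k - 1) <#>\<^bsub>K\<^esub> {\<one>\<^bsub>K\<^esub>, ?a [^]\<^bsub>K\<^esub> j} = powers_upto K ?a (2 * k - 1)"
    using f_mult[OF powers_in_PH[OF x] pair_in_PH[OF xk], of "k - 1"] f_powers_upto[OF x]
      f_pair_pullback[OF xk] j(2) by simp
  then have eq: "(\<lambda>i. ?a [^]\<^bsub>K\<^esub> i) ` ({..k - 1} \<union> {j..j + (k - 1)}) = powers_upto K ?a (2 * k - 1)"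
    unfolding K.powers_upto_mult_pair[OF pullback_closed[OF x]] .
  have wrap: "\<exists>i \<in> {..k - 1} \<union> {j..j + (k - 1)}. i = l \<or> i = l + ?n" if l: "l \<le> 2 * k - 1" for l
  proof -
    have "?a [^]\<^bsub>K\<^esub> l \<in> (\<lambda>i. ?a [^]\<^bsub>K\<^esub> i) ` ({..k - 1} \<union> {j..j + (k - 1)})"
      unfolding eq using l by (auto simp: mem_powers_upto)
    then obtain i where i: "i \<in> {..k - 1} \<union> {j..j + (k - 1)}" "?a [^]\<^bsub>K\<^esub> l = ?a [^]\<^bsub>K\<^esub> i"
      by blast
    have "l = i mod ?n"
      using i(2) l k K_pow_eq_iff[OF x] by simp
    moreover have "i < 2 * ?n" using i(1) j k by auto
    ultimately have "i = l \<or> i = l + ?n"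
      by (cases "i < ?n") (simp_all add: le_mod_geq)
    then show ?thesis using i(1) by blast
  qed
  \<comment> \<open>The exponents \<open>k\<close> and \<open>2 k - 1\<close> can only be covered by the second interval, without wrapping.\<close>
  have "j \<le> k"
    using wrap[of k] k j(1) by fastforce
  moreover have "k \<le> j"
    using wrap[of "2 * k - 1"] k j(1) by fastforce
  ultimately show ?thesis using j by simp
qed

text \<open>
For order \<open>n \<ge> 3\<close> the product \<open>{1, x}^(n-3) {1, x^-1}\<close> misses \<open>x^(n-2)\<close>, so it is not the whole
cyclic group.  If \<open>g (x^-1) = a^j\<close>, then \<open>{1, a}^(n-3) {1, a^j}\<close> is the whole cyclic group whenever
\<open>2 \<le> j \<le> n - 2\<close>.  Injectivity of \<open>g\<close> excludes \<open>j = 0\<close> and \<open>j = 1\<close>, so only \<open>j = n - 1\<close> is left.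
\<close>

lemma pullback_inv:
  assumes x: "x \<in> carrier H"
  shows "pullback (inv x) = inv\<^bsub>K\<^esub> (pullback x)"
proof -
  let ?n = "H.ord x" and ?a = "pullback x"
  have ix: "inv x \<in> carrier H" using x by simp
  have inv_eq: "inv x = x [^] (?n - 1)" using H.inv_eq_pow[OF x ord_pos[OF x]] .
  have inv_a: "inv\<^bsub>K\<^esub> ?a = ?a [^]\<^bsub>K\<^esub> (?n - 1)"
    using K.inv_eq_pow[OF pullback_closed[OF x]] ord_pos[OF x] x by simp
  consider "?n = 1" | "?n = 2" | "3 \<le> ?n" using ord_pos[OF x] by linarith
  then show ?thesis
  proof cases
    case 1
    then have "x = \<one>" using H.ord_eq_1[OF x] by simp
    then show ?thesis by simp
  next
    case 2
    then show ?thesis using inv_eq inv_a x by simp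
  next
    case 3
    obtain j where j: "j < ?n" "pullback (inv x) = ?a [^]\<^bsub>K\<^esub> j"
      using pullback_pow_mem[OF x, of "?n - 1"] inv_eq by metis
    have j0: "j \<noteq> 0"
    proof
      assume "j = 0"
      then have "inv x = \<one>" using j pullback_inj[OF ix, of \<one>] by simp
      then have "x = \<one>" using x H.inv_eq_1_iff by blast
      then show False using 3 by simp
    qed
    have j1: "j \<noteq> 1"
    proof
      assume "j = 1"
      then have "inv x = x" using j pullback_inj[OF ix x] x by simp
      then have "x [^] (?n - 1) = x [^] (1::nat)" using inv_eq x by simp
      then have "(?n - 1) mod ?n = 1 mod ?n" using H.pow_eq_iff_mod[OF x] by metis
      then show False using 3 by simp
    qed
    have "\<not> j \<le> ?n - 2"
    proof
      assume le: "j \<le> ?n - 2"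
      have "powers_upto K ?a (?n - 3) <#>\<^bsub>K\<^esub> {\<one>\<^bsub>K\<^esub>, ?a [^]\<^bsub>K\<^esub> j} = powers_upto K ?a (?n - 1)"
      proof -
        have "{..?n - 3} \<union> {j..j + (?n - 3)} = {..j + (?n - 3)}"
          using le j0 j1 3 by auto
        then have "powers_upto K ?a (?n - 3) <#>\<^bsub>K\<^esub> {\<one>\<^bsub>K\<^esub>, ?a [^]\<^bsub>K\<^esub> j} = powers_upto K ?a (j + (?n - 3))"
          unfolding K.powers_upto_mult_pair[OF pullback_closed[OF x]]
          by (simp add: powers_upto_def)
        also have "\<dots> = powers_upto K ?a (?n - 1)"
          using K.powers_upto_ord[OF pullback_closed[OF x], of "j + (?n - 3)"] x 3 j0 j1 by simp
        finally show ?thesis .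
      qed
      then have "f (powers_upto H x (?n - 3) <#> {\<one>, inv x}) = f (powers_upto H x (?n - 1))"
        using f_mult[OF powers_in_PH[OF x] pair_in_PH[OF ix], of "?n - 3"] f_powers_upto[OF x]
          f_pair_pullback[OF ix] j(2) by simp
      then have "powers_upto H x (?n - 3) <#> {\<one>, x [^] (?n - 1)} = powers_upto H x (?n - 1)"
        using f_inj PH_mult powers_in_PH[OF x] pair_in_PH[OF ix] inv_eq by metis
      moreover have "x [^] (?n - 2) \<in> powers_upto H x (?n - 1)"
        by (rule H.pow_mem_powers_upto_ord[OF x ord_pos[OF x]])
      ultimately have "x [^] (?n - 2) \<in> (\<lambda>i. x [^] i) ` ({..?n - 3} \<union> {?n - 1..?n - 1 + (?n - 3)})"
        unfolding H.powers_upto_mult_pair[OF x] by simp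
      then obtain i where i: "i \<in> {..?n - 3} \<union> {?n - 1..?n - 1 + (?n - 3)}"
        "x [^] (?n - 2) = x [^] i"
        by blast
      then have "(?n - 2) mod ?n = i mod ?n" using H.pow_eq_iff_mod[OF x] by simp
      moreover have "i mod ?n = (if i < ?n then i else i - ?n)"
        using i(1) 3 by (auto simp: le_mod_geq)
      ultimately show False using 3 i(1) by (auto split: if_splits)
    qed
    then have "j = ?n - 1" using j(1) by linarith
    then show ?thesis using j(2) inv_a by simp
  qed
qed

text \<open>
After reducing \<open>k\<close> modulo the order \<open>n\<close>, either \<open>2 k \<le> n\<close>, or \<open>x^k\<close> is the power of \<open>x^-1\<close> with
exponent \<open>n - k \<le> n / 2\<close>.
\<close>

lemma pullback_pow:
  assumes x: "x \<in> carrier H"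
  shows "pullback (x [^] (k::nat)) = pullback x [^]\<^bsub>K\<^esub> k"
proof -
  let ?n = "H.ord x" and ?a = "pullback x"
  define l where "l = k mod ?n"
  have l: "l < ?n" using ord_pos[OF x] by (simp add: l_def)
  have "pullback (x [^] l) = ?a [^]\<^bsub>K\<^esub> l"
  proof -
    consider "l = 0" | "1 \<le> l" "2 * l \<le> ?n" | "?n < 2 * l" by linarith
    then show ?thesis
    proof cases
      case 2
      then show ?thesis using pullback_pow_small[OF x] by simp
    next
      case 3
      define m where "m = ?n - l"
      have m: "1 \<le> m" "2 * m \<le> ?n" "m + l = ?n" using 3 l by (auto simp: m_def)
      have inv_pow: "inv x [^] m = x [^] l"
      proof -
        have "x [^] l \<otimes> x [^] m = \<one>"
          using m x by (simp add: H.nat_pow_mult add.commute)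
        then have "x [^] l = inv (x [^] m)"
          using x by (metis H.inv_equality H.nat_pow_closed)
        then show ?thesis using H.nat_pow_inv[OF x] by simp
      qed
      have "?a [^]\<^bsub>K\<^esub> l \<otimes>\<^bsub>K\<^esub> ?a [^]\<^bsub>K\<^esub> m = \<one>\<^bsub>K\<^esub>"
        using m x K.pow_ord_eq_1[OF pullback_closed[OF x]] by (simp add: K.nat_pow_mult add.commute)
      then have "?a [^]\<^bsub>K\<^esub> l = inv\<^bsub>K\<^esub> (?a [^]\<^bsub>K\<^esub> m)"
        using x by (metis K.inv_equality K.nat_pow_closed pullback_closed)
      also have "\<dots> = inv\<^bsub>K\<^esub> ?a [^]\<^bsub>K\<^esub> m"
        using K.nat_pow_inv[OF pullback_closed[OF x]] by simp
      also have "\<dots> = pullback (inv x [^] m)"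
        using pullback_pow_small[of "inv x" m] m x pullback_inv[OF x] by simp
      finally show ?thesis using inv_pow by simp
    qed simp
  qed
  moreover have "x [^] l = x [^] k"
    using H.pow_eq_iff_mod[OF x] by (simp add: l_def)
  moreover have "?a [^]\<^bsub>K\<^esub> l = ?a [^]\<^bsub>K\<^esub> k"
    using K_pow_eq_iff[OF x] by (simp add: l_def)
  ultimately show ?thesis by simp
qed

section \<open>The induced map is multiplicative\<close>

text \<open>
Let \<open>L\<close> be the subgroup generated by \<open>y\<close> and \<open>M\<close> the one generated by \<open>b = g y\<close>.  Since
\<open>(x y) L = x L\<close>, the pairs \<open>{1, x y}\<close> and \<open>{1, x}\<close> have the same product with \<open>L\<close>.  Hence
\<open>g (x y)\<close> lies in \<open>M\<close> or in \<open>g x M\<close>, and the first is impossible because \<open>x\<close> is not a power of \<open>y\<close>.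
\<close>

lemma pullback_mult_mem_coset:
  assumes x: "x \<in> carrier H" and y: "y \<in> carrier H" and nmem: "\<And>k::nat. x \<noteq> y [^] k"
  obtains e where "e < H.ord y" "pullback (x \<otimes> y) = pullback x \<otimes>\<^bsub>K\<^esub> pullback y [^]\<^bsub>K\<^esub> (e::nat)"
proof -
  let ?n = "H.ord y" and ?a = "pullback x" and ?b = "pullback y" and ?c = "pullback (x \<otimes> y)"
  let ?L = "powers_upto H y (?n - 1)" and ?M = "powers_upto K ?b (?n - 1)"
  have xy: "x \<otimes> y \<in> carrier H" using x y by simp
  have b: "?b \<in> carrier K" and ord_b: "K.ord ?b = ?n" "0 < ?n" using y ord_pos[OF y] by simp_all
  have nmem_c: "?c \<noteq> ?b [^]\<^bsub>K\<^esub> (k::nat)" for k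
  proof
    assume "?c = ?b [^]\<^bsub>K\<^esub> k"
    then have "x \<otimes> y = y [^] k"
      using pullback_inj[OF xy, of "y [^] k"] pullback_pow[OF y] y by simp
    also have "\<dots> = y [^] (k + ?n)" using H.pow_eq_iff_mod[OF y] by simp
    also have "\<dots> = y [^] (k + (?n - 1)) \<otimes> y"
      using ord_b(2) H.nat_pow_Suc[of y "k + (?n - 1)"] by (simp del: H.nat_pow_Suc)
    finally have "x = y [^] (k + (?n - 1))" using x y by simp
    then show False using nmem by blast
  qed
  have shift: "{\<one>, x \<otimes> y} <#> ?L \<subseteq> {\<one>, x} <#> ?L"
  proof
    fix z assume "z \<in> {\<one>, x \<otimes> y} <#> ?L"
    then obtain i where "z = \<one> \<otimes> y [^] (i::nat) \<or> z = x \<otimes> y \<otimes> y [^] i"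
      unfolding mem_pair_powers by blast
    moreover have "x \<otimes> y \<otimes> y [^] i = x \<otimes> y [^] (Suc i)"
      using x y by (simp only: H.m_assoc H.nat_pow_Suc2 H.nat_pow_closed)
    ultimately show "z \<in> {\<one>, x} <#> ?L"
      using H.pow_mem_powers_upto_ord[OF y ord_b(2)] unfolding mem_pair_powers mem_powers_upto by metis
  qed
  have "{\<one>, x} <#> ?L \<subseteq> {\<one>, x \<otimes> y} <#> ?L"
  proof
    fix z assume "z \<in> {\<one>, x} <#> ?L"
    then obtain i where "z = \<one> \<otimes> y [^] (i::nat) \<or> z = x \<otimes> y [^] i"
      unfolding mem_pair_powers by blast
    moreover have "x \<otimes> y [^] i = x \<otimes> y \<otimes> y [^] (i + (?n - 1))"
    proof -
      have "y [^] i = y [^] Suc (i + (?n - 1))"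
        using H.pow_eq_iff_mod[OF y] ord_b(2) by (simp del: H.nat_pow_Suc)
      then show ?thesis using x y by (simp only: H.m_assoc H.nat_pow_Suc2 H.nat_pow_closed)
    qed
    ultimately show "z \<in> {\<one>, x \<otimes> y} <#> ?L"
      using H.pow_mem_powers_upto_ord[OF y ord_b(2)] unfolding mem_pair_powers mem_powers_upto by metis
  qed
  with shift have "f ({\<one>, x \<otimes> y} <#> ?L) = f ({\<one>, x} <#> ?L)" by (metis subset_antisym)
  then have eq: "{\<one>\<^bsub>K\<^esub>, ?c} <#>\<^bsub>K\<^esub> ?M = {\<one>\<^bsub>K\<^esub>, ?a} <#>\<^bsub>K\<^esub> ?M"
    by (simp only: f_mult[OF pair_in_PH[OF xy] powers_in_PH[OF y]] f_mult[OF pair_in_PH[OF x] powers_in_PH[OF y]]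
        f_pair_pullback[OF xy] f_pair_pullback[OF x] f_powers_upto[OF y])
  have "\<one>\<^bsub>K\<^esub> \<in> ?M" using K.powers_upto_in_power_monoid[OF b] by simp
  then have "?c \<otimes>\<^bsub>K\<^esub> \<one>\<^bsub>K\<^esub> \<in> {\<one>\<^bsub>K\<^esub>, ?c} <#>\<^bsub>K\<^esub> ?M" unfolding mem_set_mult by blast
  then have "?c \<in> {\<one>\<^bsub>K\<^esub>, ?a} <#>\<^bsub>K\<^esub> ?M" using eq xy by simp
  then obtain e where e: "e \<le> ?n - 1" "?c = \<one>\<^bsub>K\<^esub> \<otimes>\<^bsub>K\<^esub> ?b [^]\<^bsub>K\<^esub> e \<or> ?c = ?a \<otimes>\<^bsub>K\<^esub> ?b [^]\<^bsub>K\<^esub> e"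
    unfolding mem_pair_powers by blast
  then have "?c = ?a \<otimes>\<^bsub>K\<^esub> ?b [^]\<^bsub>K\<^esub> e" using nmem_c[of e] b by auto
  moreover have "e < ?n" using e(1) ord_b(2) by linarith
  ultimately show ?thesis using that by blast
qed

text \<open>
Let \<open>p + 1\<close> be the least positive exponent for which the power of \<open>x\<close> is a power of \<open>y\<close>, and write
\<open>g (x y) = a b^e\<close> as in \<open>pullback_mult_mem_coset\<close>.  The image of \<open>grid_relation\<close> under \<open>f\<close> equates two
sets of products \<open>a^i b^j\<close>.  By minimality of \<open>p + 1\<close>, the members with \<open>i = 1\<close> are the only ones in the
coset of \<open>a\<close>, and comparing them gives
\<open>[0, s] \<union> [e, e + s] = [0, s + 1]\<close> for exponents modulo the order of \<open>b\<close>.  When \<open>s + 3\<close> is at most this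
order, the interval on the right omits a residue, and \<open>e = 1\<close> is the only solution.
\<close>

lemma pullback_mult_grid:
  assumes x: "x \<in> carrier H" and y: "y \<in> carrier H"
    and minimal: "\<And>i k. 1 \<le> i \<Longrightarrow> i \<le> p \<Longrightarrow> x [^] i \<noteq> y [^] (k::nat)" and p: "1 \<le> p"
    and rel: "x [^] Suc p = y [^] (s::nat)" and s: "s + 3 \<le> H.ord y"
  shows "pullback (x \<otimes> y) = pullback x \<otimes>\<^bsub>K\<^esub> pullback y"
proof -
  let ?m = "H.ord y" and ?a = "pullback x" and ?b = "pullback y" and ?c = "pullback (x \<otimes> y)"
  have xy: "x \<otimes> y \<in> carrier H" using x y by simp
  have a: "?a \<in> carrier K" and b: "?b \<in> carrier K" using x y by simp_all
  have "x \<noteq> y [^] (k::nat)" for k using minimal[of 1 k] p x by simp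
  then obtain e where e: "e < ?m" "?c = ?a \<otimes>\<^bsub>K\<^esub> ?b [^]\<^bsub>K\<^esub> e"
    using pullback_mult_mem_coset[OF x y] by blast
  have minimal_K: "?a [^]\<^bsub>K\<^esub> i \<noteq> ?b [^]\<^bsub>K\<^esub> k" if "1 \<le> i" "i \<le> p" for i k :: nat
  proof
    assume "?a [^]\<^bsub>K\<^esub> i = ?b [^]\<^bsub>K\<^esub> k"
    then have "x [^] i = y [^] k"
      using pullback_inj[of "x [^] i" "y [^] k"] x y by (simp add: pullback_pow)
    then show False using minimal that by blast
  qed
  have K_pow_b: "?b [^]\<^bsub>K\<^esub> (i::nat) = ?b [^]\<^bsub>K\<^esub> (j::nat) \<longleftrightarrow> i mod ?m = j mod ?m" for i j
    by (rule K_pow_eq_iff[OF y])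
  have coset: "i = 1 \<and> j mod ?m = k mod ?m"
    if eq: "?a [^]\<^bsub>K\<^esub> i \<otimes>\<^bsub>K\<^esub> ?b [^]\<^bsub>K\<^esub> j = ?a \<otimes>\<^bsub>K\<^esub> ?b [^]\<^bsub>K\<^esub> k" and i: "i \<le> Suc p" for i j k :: nat
  proof -
    \<comment> \<open>The exponent \<open>(?m - 1) * j\<close> replaces the negative exponent \<open>- j\<close>.\<close>
    have fold: "u = ?b [^]\<^bsub>K\<^esub> (t + (?m - 1) * j)"
      if "u \<otimes>\<^bsub>K\<^esub> ?b [^]\<^bsub>K\<^esub> j = ?b [^]\<^bsub>K\<^esub> t" "u \<in> carrier K" for u and t j :: nat
    proof -
      have "(?m - 1) * j + j = ?m * j" using e(1) by (cases ?m) auto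
      then have "?b [^]\<^bsub>K\<^esub> t = ?b [^]\<^bsub>K\<^esub> (t + (?m - 1) * j + j)"
        unfolding K_pow_b by (metis add.assoc mod_mult_self2)
      then have "u \<otimes>\<^bsub>K\<^esub> ?b [^]\<^bsub>K\<^esub> j = ?b [^]\<^bsub>K\<^esub> (t + (?m - 1) * j) \<otimes>\<^bsub>K\<^esub> ?b [^]\<^bsub>K\<^esub> j"
        using that b by (simp add: K.nat_pow_mult)
      then show ?thesis using that(2) b by simp
    qed
    consider "i = 0" | "i = 1" | i' where "i = Suc i'" "1 \<le> i'" "i' \<le> p"
      using i by (cases i) (auto, linarith)
    then show ?thesis
    proof cases
      case 1
      then have "?a \<otimes>\<^bsub>K\<^esub> ?b [^]\<^bsub>K\<^esub> k = ?b [^]\<^bsub>K\<^esub> j" using eq b by simp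
      then have "?a [^]\<^bsub>K\<^esub> (1::nat) = ?b [^]\<^bsub>K\<^esub> (j + (?m - 1) * k)" using fold a by simp
      then show ?thesis using minimal_K[of 1] p by blast
    next
      case 2
      then have "?b [^]\<^bsub>K\<^esub> j = ?b [^]\<^bsub>K\<^esub> k" using eq a b by simp
      then show ?thesis using 2 K_pow_b by blast
    next
      case (3 i')
      have "?a \<otimes>\<^bsub>K\<^esub> (?a [^]\<^bsub>K\<^esub> i' \<otimes>\<^bsub>K\<^esub> ?b [^]\<^bsub>K\<^esub> j) = ?a \<otimes>\<^bsub>K\<^esub> ?b [^]\<^bsub>K\<^esub> k"
        using eq 3 a b by (simp only: K.nat_pow_Suc2 K.m_assoc K.nat_pow_closed)
      then have "?a [^]\<^bsub>K\<^esub> i' \<otimes>\<^bsub>K\<^esub> ?b [^]\<^bsub>K\<^esub> j = ?b [^]\<^bsub>K\<^esub> k" using a b by simp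
      then have "?a [^]\<^bsub>K\<^esub> i' = ?b [^]\<^bsub>K\<^esub> (k + (?m - 1) * j)" using fold a by simp
      then show ?thesis using minimal_K 3 by blast
    qed
  qed
  have step: "?a [^]\<^bsub>K\<^esub> i \<otimes>\<^bsub>K\<^esub> ?c \<otimes>\<^bsub>K\<^esub> ?b [^]\<^bsub>K\<^esub> j = ?a [^]\<^bsub>K\<^esub> Suc i \<otimes>\<^bsub>K\<^esub> ?b [^]\<^bsub>K\<^esub> (e + j)" for i j :: nat
    using a b e(2) K.nat_pow_mult[OF b, of e j] by (simp add: K.m_assoc)
  have one: "?a [^]\<^bsub>K\<^esub> i \<otimes>\<^bsub>K\<^esub> \<one>\<^bsub>K\<^esub> = ?a [^]\<^bsub>K\<^esub> i" for i :: nat using a by simp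
  let ?S = "(powers_upto K ?a p <#>\<^bsub>K\<^esub> {\<one>\<^bsub>K\<^esub>, ?c}) <#>\<^bsub>K\<^esub> powers_upto K ?b s"
  have "?S = f ((powers_upto H x p <#> {\<one>, x \<otimes> y}) <#> powers_upto H y s)"
    by (simp only: f_mult[OF PH_mult[OF powers_in_PH[OF x] pair_in_PH[OF xy]] powers_in_PH[OF y]]
      f_mult[OF powers_in_PH[OF x] pair_in_PH[OF xy]] f_powers_upto[OF x] f_powers_upto[OF y] f_pair_pullback[OF xy])
  also have "\<dots> = f (powers_upto H x (Suc p) <#> powers_upto H y (Suc s))"
    by (simp only: H.grid_relation[OF x y rel])
  also have "\<dots> = powers_upto K ?a (Suc p) <#>\<^bsub>K\<^esub> powers_upto K ?b (Suc s)"
    by (simp only: f_mult[OF powers_in_PH[OF x] powers_in_PH[OF y]] f_powers_upto[OF x] f_powers_upto[OF y])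
  finally have eq: "?S = powers_upto K ?a (Suc p) <#>\<^bsub>K\<^esub> powers_upto K ?b (Suc s)" .
  have a1: "?a = ?a [^]\<^bsub>K\<^esub> (1::nat)" using a by simp
  \<comment> \<open>On the coset of \<open>a\<close>, the interval \<open>[e, e + s]\<close> lies in \<open>[0, s + 1]\<close>, and it contains \<open>s + 1\<close>.\<close>
  have inside: "(e + j) mod ?m \<le> Suc s" if "j \<le> s" for j
  proof -
    have "?a [^]\<^bsub>K\<^esub> (0::nat) \<otimes>\<^bsub>K\<^esub> ?c \<otimes>\<^bsub>K\<^esub> ?b [^]\<^bsub>K\<^esub> j \<in> ?S"
      unfolding mem_powers_pair_powers using that by blast
    then obtain i k where ik: "i \<le> Suc p" "k \<le> Suc s"
      "?a [^]\<^bsub>K\<^esub> Suc 0 \<otimes>\<^bsub>K\<^esub> ?b [^]\<^bsub>K\<^esub> (e + j) = ?a [^]\<^bsub>K\<^esub> i \<otimes>\<^bsub>K\<^esub> ?b [^]\<^bsub>K\<^esub> k"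
      unfolding eq mem_powers_powers step by blast
    then have "k mod ?m = (e + j) mod ?m" using coset[of i k "e + j"] a by simp
    then show ?thesis using ik(2) s by simp
  qed
  have top: "\<exists>j\<le>s. (e + j) mod ?m = Suc s"
  proof -
    have "?a [^]\<^bsub>K\<^esub> (1::nat) \<otimes>\<^bsub>K\<^esub> ?b [^]\<^bsub>K\<^esub> Suc s \<in> ?S"
      unfolding eq mem_powers_powers using le_add1[of 1 p] unfolding plus_1_eq_Suc by blast
    then obtain i j where ij: "i \<le> p" "j \<le> s"
      "?a \<otimes>\<^bsub>K\<^esub> ?b [^]\<^bsub>K\<^esub> Suc s = ?a [^]\<^bsub>K\<^esub> i \<otimes>\<^bsub>K\<^esub> ?b [^]\<^bsub>K\<^esub> j \<or>
       ?a \<otimes>\<^bsub>K\<^esub> ?b [^]\<^bsub>K\<^esub> Suc s = ?a [^]\<^bsub>K\<^esub> Suc i \<otimes>\<^bsub>K\<^esub> ?b [^]\<^bsub>K\<^esub> (e + j)"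
      unfolding mem_powers_pair_powers step one a1[symmetric] by blast
    from ij(3) show ?thesis
    proof
      assume "?a \<otimes>\<^bsub>K\<^esub> ?b [^]\<^bsub>K\<^esub> Suc s = ?a [^]\<^bsub>K\<^esub> i \<otimes>\<^bsub>K\<^esub> ?b [^]\<^bsub>K\<^esub> j"
      then have "j mod ?m = Suc s mod ?m" using coset[of i j "Suc s"] ij(1) by simp
      then show ?thesis using ij(2) s by simp
    next
      assume "?a \<otimes>\<^bsub>K\<^esub> ?b [^]\<^bsub>K\<^esub> Suc s = ?a [^]\<^bsub>K\<^esub> Suc i \<otimes>\<^bsub>K\<^esub> ?b [^]\<^bsub>K\<^esub> (e + j)"
      then have "(e + j) mod ?m = Suc s mod ?m" using coset[of "Suc i" "e + j" "Suc s"] ij(1) by simp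
      then show ?thesis using ij(2) s by auto
    qed
  qed
  have "e = 1"
  proof -
    \<comment> \<open>Otherwise \<open>[e, e + s]\<close> passes through \<open>?m - 1\<close>, which exceeds \<open>s + 1\<close>.\<close>
    have "e + s < ?m"
    proof (rule ccontr)
      assume "\<not> e + s < ?m"
      then have "?m - 1 - e \<le> s" using s by linarith
      then have "(e + (?m - 1 - e)) mod ?m \<le> Suc s" by (rule inside)
      moreover have "e + (?m - 1 - e) = ?m - 1" using e(1) by linarith
      ultimately show False using s by simp
    qed
    moreover obtain j where "j \<le> s" "(e + j) mod ?m = Suc s" using top by blast
    ultimately show ?thesis using inside[of s] by simp
  qed
  then show ?thesis using e(2) b by simp
qed

text \<open>
For \<open>y \<noteq> 1\<close>, use that \<open>x y^2 = x^-1\<close> and \<open>x (x y) y = 1\<close>, which makes both \<open>{1, x} {1, x y} {1, y}\<close> and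
\<open>{1, x} {1, x^-1} {1, x y}\<close> equal to \<open>{1, x, x^-1, y, x y, x (x y)}\<close>.  Apply \<open>f\<close> to this identity.
The image of the first product contains \<open>a b\<close>, and among the members \<open>1, a, a^-1, c, a c, a^-1 c\<close> of the
image of the second one, only \<open>c = g (x y)\<close> can be equal to it.
\<close>

lemma pullback_mult_squares:
  assumes x: "x \<in> carrier H" and y: "y \<in> carrier H" and nmem: "\<And>k::nat. x \<noteq> y [^] k"
    and rel: "x [^] (2::nat) \<otimes> y [^] (2::nat) = \<one>"
  shows "pullback (x \<otimes> y) = pullback x \<otimes>\<^bsub>K\<^esub> pullback y"
proof (cases "y = \<one>")
  case True
  then show ?thesis using x by simp
next
  case y1: False
  let ?a = "pullback x" and ?b = "pullback y" and ?c = "pullback (x \<otimes> y)"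
  have xy: "x \<otimes> y \<in> carrier H" and ix: "inv x \<in> carrier H" using x y by simp_all
  have a: "?a \<in> carrier K" and b: "?b \<in> carrier K" using x y by simp_all
  obtain e where e: "?c = ?a \<otimes>\<^bsub>K\<^esub> ?b [^]\<^bsub>K\<^esub> (e::nat)"
    using pullback_mult_mem_coset[OF x y nmem] by blast
  have rel': "x \<otimes> (x \<otimes> y) \<otimes> y = \<one>"
    using rel x y by (simp add: numeral_2_eq_2 H.m_assoc)
  have inv_x: "x \<otimes> y \<otimes> y = inv x"
  proof -
    have "x \<otimes> (x \<otimes> y \<otimes> y) = \<one>" using rel' x y by (simp add: H.m_assoc)
    then show ?thesis using x y H.inv_equality H.inv_comm by (metis H.m_closed)
  qed
  have "({\<one>, x} <#> {\<one>, x \<otimes> y}) <#> {\<one>, y} = {\<one>, x, x \<otimes> y, x \<otimes> (x \<otimes> y), y, inv x}"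
    using rel' inv_x x y by (simp add: H.mult_pair) blast
  moreover have "({\<one>, x} <#> {\<one>, inv x}) <#> {\<one>, x \<otimes> y} = {\<one>, x, x \<otimes> y, x \<otimes> (x \<otimes> y), y, inv x}"
    using x y by (simp add: H.mult_pair H.inv_solve_left' H.m_assoc[symmetric]) blast
  ultimately have "f (({\<one>, x} <#> {\<one>, x \<otimes> y}) <#> {\<one>, y}) = f (({\<one>, x} <#> {\<one>, inv x}) <#> {\<one>, x \<otimes> y})"
    by simp
  then have eq: "({\<one>\<^bsub>K\<^esub>, ?a} <#>\<^bsub>K\<^esub> {\<one>\<^bsub>K\<^esub>, ?c}) <#>\<^bsub>K\<^esub> {\<one>\<^bsub>K\<^esub>, ?b}
      = ({\<one>\<^bsub>K\<^esub>, ?a} <#>\<^bsub>K\<^esub> {\<one>\<^bsub>K\<^esub>, inv\<^bsub>K\<^esub> ?a}) <#>\<^bsub>K\<^esub> {\<one>\<^bsub>K\<^esub>, ?c}"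
    by (simp only: f_mult[OF PH_mult[OF pair_in_PH[OF x] pair_in_PH[OF xy]] pair_in_PH[OF y]]
      f_mult[OF pair_in_PH[OF x] pair_in_PH[OF xy]] f_mult[OF pair_in_PH[OF x] pair_in_PH[OF ix]]
      f_mult[OF PH_mult[OF pair_in_PH[OF x] pair_in_PH[OF ix]] pair_in_PH[OF xy]]
      f_pair_pullback[OF x] f_pair_pullback[OF y] f_pair_pullback[OF xy] f_pair_pullback[OF ix] pullback_inv[OF x])
  have c: "?c \<in> carrier K" using xy by simp
  have nmem_K: "?a \<noteq> ?b [^]\<^bsub>K\<^esub> (k::nat)" for k
    using pullback_inj[of x "y [^] k"] nmem x y by (auto simp: pullback_pow)
  have nmem_K': "?a \<otimes>\<^bsub>K\<^esub> ?b [^]\<^bsub>K\<^esub> (j::nat) \<noteq> ?b [^]\<^bsub>K\<^esub> (k::nat)" for j k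
  proof
    assume eq: "?a \<otimes>\<^bsub>K\<^esub> ?b [^]\<^bsub>K\<^esub> j = ?b [^]\<^bsub>K\<^esub> k"
    have "inv\<^bsub>K\<^esub> (?b [^]\<^bsub>K\<^esub> j) = ?b [^]\<^bsub>K\<^esub> (j * (K.ord (?b [^]\<^bsub>K\<^esub> j) - 1))"
      using K.inv_eq_pow[of "?b [^]\<^bsub>K\<^esub> j"] ord_pullback[of "y [^] j"] ord_pos[of "y [^] j"] b y
      by (simp add: pullback_pow K.nat_pow_pow)
    moreover have "?a = ?b [^]\<^bsub>K\<^esub> k \<otimes>\<^bsub>K\<^esub> inv\<^bsub>K\<^esub> (?b [^]\<^bsub>K\<^esub> j)"
      using eq a b by (simp add: K.inv_solve_right)
    ultimately show False using nmem_K b by (simp add: K.nat_pow_mult)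
  qed
  have b1: "?b \<noteq> \<one>\<^bsub>K\<^esub>" using pullback_inj[OF y, of \<one>] y1 by auto
  have "?a \<otimes>\<^bsub>K\<^esub> ?b \<in> ({\<one>\<^bsub>K\<^esub>, ?a} <#>\<^bsub>K\<^esub> {\<one>\<^bsub>K\<^esub>, inv\<^bsub>K\<^esub> ?a}) <#>\<^bsub>K\<^esub> {\<one>\<^bsub>K\<^esub>, ?c}"
    unfolding eq[symmetric] using a b c by (simp add: K.mult_pair)
  then have "?a \<otimes>\<^bsub>K\<^esub> ?b \<in> {\<one>\<^bsub>K\<^esub>, ?a, inv\<^bsub>K\<^esub> ?a, ?c, ?a \<otimes>\<^bsub>K\<^esub> ?c, inv\<^bsub>K\<^esub> ?a \<otimes>\<^bsub>K\<^esub> ?c}"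
    using a c by (auto simp: K.mult_pair)
  moreover have "?a \<otimes>\<^bsub>K\<^esub> ?b \<noteq> \<one>\<^bsub>K\<^esub>"
    using nmem_K'[of 1 0] b by simp
  moreover have "?a \<otimes>\<^bsub>K\<^esub> ?b \<noteq> ?a"
    using a b b1 by simp
  moreover have "?a \<otimes>\<^bsub>K\<^esub> ?b \<noteq> inv\<^bsub>K\<^esub> ?a"
  proof
    assume "?a \<otimes>\<^bsub>K\<^esub> ?b = inv\<^bsub>K\<^esub> ?a"
    have "?a [^]\<^bsub>K\<^esub> (2::nat) \<otimes>\<^bsub>K\<^esub> ?b [^]\<^bsub>K\<^esub> (2::nat) = \<one>\<^bsub>K\<^esub>"
    proof -
      have "x [^] (2::nat) = inv (y [^] (2::nat))"
        using rel x y by (metis H.inv_equality H.nat_pow_closed)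
      then have "?a [^]\<^bsub>K\<^esub> (2::nat) = inv\<^bsub>K\<^esub> (?b [^]\<^bsub>K\<^esub> (2::nat))"
        using pullback_pow[OF x, of 2] pullback_pow[OF y, of 2] pullback_inv[of "y [^] (2::nat)"] y by simp
      then show ?thesis using b by simp
    qed
    then have "?a \<otimes>\<^bsub>K\<^esub> (?a \<otimes>\<^bsub>K\<^esub> ?b \<otimes>\<^bsub>K\<^esub> ?b) = \<one>\<^bsub>K\<^esub>"
      using a b by (simp add: numeral_2_eq_2 K.m_assoc)
    then have "?a \<otimes>\<^bsub>K\<^esub> (inv\<^bsub>K\<^esub> ?a \<otimes>\<^bsub>K\<^esub> ?b) = \<one>\<^bsub>K\<^esub>"
      using \<open>?a \<otimes>\<^bsub>K\<^esub> ?b = inv\<^bsub>K\<^esub> ?a\<close> by simp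
    then show False using a b b1 by (simp flip: K.m_assoc)
  qed
  moreover have "?a \<otimes>\<^bsub>K\<^esub> ?b \<noteq> ?a \<otimes>\<^bsub>K\<^esub> ?c"
    using nmem_K'[of e 1] a b c e by auto
  moreover have "?a \<otimes>\<^bsub>K\<^esub> ?b \<noteq> inv\<^bsub>K\<^esub> ?a \<otimes>\<^bsub>K\<^esub> ?c"
    using nmem_K'[of 1 e] a b unfolding e by (simp flip: K.m_assoc)
  ultimately have "?a \<otimes>\<^bsub>K\<^esub> ?b = ?c" by blast
  then show ?thesis by simp
qed

text \<open>
Assume that neither of \<open>x\<close> and \<open>y\<close> is a power of the other.  Let \<open>r\<close> be the least positive exponent
such that \<open>x^r\<close> is a power \<open>y^s\<close>, where \<open>s\<close> is less than the order \<open>m\<close> of \<open>y\<close>.  The lemma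
\<open>pullback_mult_grid\<close> applies unless \<open>s \<ge> m - 2\<close>.  If \<open>s = m - 1\<close>, then \<open>y\<close> would be a power of \<open>x\<close>; if
\<open>s = m - 2\<close>, then \<open>x^r y^2 = 1\<close>.
\<close>

lemma pullback_mult:
  assumes x: "x \<in> carrier H" and y: "y \<in> carrier H"
  shows "pullback (x \<otimes> y) = pullback x \<otimes>\<^bsub>K\<^esub> pullback y"
proof (cases "(\<exists>k::nat. x = y [^] k) \<or> (\<exists>k::nat. y = x [^] k)")
  case True
  then show ?thesis
  proof (elim disjE exE)
    fix k :: nat assume k: "x = y [^] k"
    then have "x \<otimes> y = y [^] Suc k" by simp
    then show ?thesis using k pullback_pow[OF y, of k] pullback_pow[OF y, of "Suc k"] by simp
  next
    fix k :: nat assume k: "y = x [^] k"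
    then have "x \<otimes> y = x [^] Suc k" using H.nat_pow_Suc2[OF x] by simp
    then show ?thesis
      using k pullback_pow[OF x, of k] pullback_pow[OF x, of "Suc k"]
        K.nat_pow_Suc2[OF pullback_closed[OF x], of k] by simp
  qed
next
  case False
  let ?n = "H.ord x" and ?m = "H.ord y"
  have xy: "x \<otimes> y \<in> carrier H" using x y by simp
  have nxy: "x \<noteq> y [^] (k::nat)" and nyx: "y \<noteq> x [^] (k::nat)" for k using False by blast+
  have n: "0 < ?n" and m: "0 < ?m" using x y ord_pos by auto
  define P where "P i \<longleftrightarrow> 0 < i \<and> (\<exists>k::nat. x [^] i = y [^] k)" for i :: nat
  define r where "r = (LEAST i. P i)"
  have Pn: "P ?n" unfolding P_def using n x by (auto intro: exI[of _ 0])
  have Pr: "P r" and r_le: "r \<le> ?n" unfolding r_def using Pn by (auto intro: LeastI Least_le)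
  have r_min: "x [^] i \<noteq> y [^] (k::nat)" if "1 \<le> i" "i < r" for i k
    using not_less_Least[of i P] that by (auto simp: P_def r_def)
  obtain k :: nat where k: "x [^] r = y [^] k" using Pr by (auto simp: P_def)
  define s where "s = k mod ?m"
  have s: "s < ?m" "x [^] r = y [^] s"
    using m k H.pow_eq_iff_mod[OF y] by (auto simp: s_def)
  have "r \<noteq> 1" using nxy s(2) x by auto
  then obtain p where p: "r = Suc p" "1 \<le> p"
    using Pr by (cases r) (auto simp: P_def)
  consider "s + 3 \<le> ?m" | "s + 1 = ?m" | "s + 2 = ?m" using s(1) by linarith
  then show ?thesis
  proof cases
    case 1
    show ?thesis
      by (rule pullback_mult_grid[OF x y _ p(2) _ 1]) (use r_min s(2) p in auto)
  next
    case 2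
    have "x [^] r \<otimes> y = \<one>" using s(2) 2 y H.nat_pow_Suc[of y s] by (simp del: H.nat_pow_Suc)
    then have "y = inv (x [^] r)" using x y by (metis H.inv_equality H.inv_inv H.nat_pow_closed)
    also have "\<dots> = (x [^] r) [^] (H.ord (x [^] r) - 1)"
      using x ord_pos by (intro H.inv_eq_pow) auto
    also have "\<dots> = x [^] (r * (H.ord (x [^] r) - 1))" using x by (simp add: H.nat_pow_pow)
    finally show ?thesis using nyx by blast
  next
    case 3
    have rel: "x [^] r \<otimes> y [^] (2::nat) = \<one>"
      using s(2) 3 y by (simp add: H.nat_pow_mult)
    show ?thesis
    proof (cases "r = 2")
      case True
      then show ?thesis using pullback_mult_squares[OF x y nxy] rel by simp
    next
      case False
      then have r3: "3 \<le> r" using p by simp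
      \<comment> \<open>In \<open>u^2 = v^(?n - r)\<close> the exponent on the right leaves enough room because \<open>r \<ge> 3\<close>, and the
        claim for \<open>u v = (x y)^-1\<close> is equivalent to the one for \<open>x y\<close>.\<close>
      define u v where "u = inv y" and "v = inv x"
      have uv: "u \<in> carrier H" "v \<in> carrier H" "H.ord v = ?n" using x y by (auto simp: u_def v_def)
      have "pullback (u \<otimes> v) = pullback u \<otimes>\<^bsub>K\<^esub> pullback v"
      proof (rule pullback_mult_grid[OF uv(1,2), where p = 1 and s = "?n - r"])
        fix i k :: nat assume "1 \<le> i" "i \<le> 1"
        then have "i = 1" by simp
        show "u [^] i \<noteq> v [^] k"
        proof
          assume "u [^] i = v [^] k"
          then have "inv y = inv (x [^] k)"
            using \<open>i = 1\<close> uv H.nat_pow_inv[OF x] by (simp add: u_def v_def)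
          then have "y = x [^] k" using x y by (metis H.inv_inv H.nat_pow_closed)
          then show False using nyx by blast
        qed
      next
        have "u [^] (2::nat) = inv (y [^] (2::nat))" using H.nat_pow_inv[OF y] by (simp add: u_def)
        also have "\<dots> = x [^] r" using rel x y by (metis H.inv_equality H.nat_pow_closed)
        also have "\<dots> = inv (x [^] (?n - r))"
        proof (rule H.inv_equality[symmetric])
          show "x [^] r \<otimes> x [^] (?n - r) = \<one>" using r_le x by (simp add: H.nat_pow_mult)
        qed (use x in auto)
        also have "\<dots> = v [^] (?n - r)" using H.nat_pow_inv[OF x] by (simp add: v_def)
        finally show "u [^] Suc 1 = v [^] (?n - r)" by (simp only: Suc_1)
      next
        show "?n - r + 3 \<le> H.ord v" using r3 r_le uv by simp
      qed simp
      moreover have "u \<otimes> v = inv (x \<otimes> y)" using x y by (simp add: u_def v_def H.inv_mult_group)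
      ultimately have "inv\<^bsub>K\<^esub> pullback (x \<otimes> y) = inv\<^bsub>K\<^esub> pullback y \<otimes>\<^bsub>K\<^esub> inv\<^bsub>K\<^esub> pullback x"
        using pullback_inv x y xy by (simp add: u_def v_def)
      also have "\<dots> = inv\<^bsub>K\<^esub> (pullback x \<otimes>\<^bsub>K\<^esub> pullback y)"
        using x y by (simp add: K.inv_mult_group)
      finally show ?thesis using x y xy by (metis K.inv_inv K.m_closed pullback_closed)
    qed
  qed
qed

section \<open>The induced map is an isomorphism\<close>

text \<open>
If \<open>1 \<noteq> x \<in> X\<close> and \<open>L\<close> is the subgroup generated by \<open>x\<close>, then \<open>x L \<subseteq> L\<close>, so \<open>x\<close> can be dropped from \<open>X\<close>
without changing \<open>X L\<close>.  Hence \<open>f X \<subseteq> f X f L = f (X - {x}) f L\<close>, where \<open>f L\<close> consists of powers of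
\<open>g x\<close>, and the range of \<open>g\<close> is closed under multiplication.
\<close>

lemma f_subset_range:
  assumes "X \<in> PH"
  shows "f X \<subseteq> pullback ` carrier H"
  using assms
proof (induction "card X" arbitrary: X rule: less_induct)
  case less
  then have X: "finite X" "X \<subseteq> carrier H" "\<one> \<in> X" by auto
  show ?case
  proof (cases "X = {\<one>}")
    case True
    then have "f X = {pullback \<one>}" using f_one by simp
    then show ?thesis using H.one_closed by blast
  next
    case False
    then obtain x where x: "x \<in> X" "x \<noteq> \<one>" using X by blast
    then have xH: "x \<in> carrier H" using X by blast
    let ?Y = "X - {x}" and ?L = "powers_upto H x (H.ord x - 1)"
    have Y: "?Y \<in> PH" using X x by auto
    have L: "x [^] (i::nat) \<in> ?L" for i
      using H.pow_mem_powers_upto_ord[OF xH ord_pos[OF xH]] .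
    have "X <#> ?L \<subseteq> ?Y <#> ?L"
    proof
      fix z assume "z \<in> X <#> ?L"
      then obtain u i where u: "u \<in> X" "z = u \<otimes> x [^] (i::nat)"
        by (auto simp: mem_set_mult mem_powers_upto)
      show "z \<in> ?Y <#> ?L"
      proof (cases "u = x")
        case True
        then have "z = \<one> \<otimes> x [^] Suc i"
          using u xH by (simp only: H.nat_pow_Suc2 H.l_one H.m_closed H.nat_pow_closed)
        then show ?thesis using L[of "Suc i"] X x unfolding mem_set_mult by blast
      next
        case False
        then show ?thesis using u L[of i] unfolding mem_set_mult by blast
      qed
    qed
    moreover have "?Y <#> ?L \<subseteq> X <#> ?L" by (auto simp: set_mult_def)
    ultimately have "f (X <#> ?L) = f (?Y <#> ?L)" by (metis subset_antisym)
    then have eq: "f X <#>\<^bsub>K\<^esub> powers_upto K (pullback x) (H.ord x - 1)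
        = f ?Y <#>\<^bsub>K\<^esub> powers_upto K (pullback x) (H.ord x - 1)"
      by (simp only: f_mult[OF less.prems powers_in_PH[OF xH]] f_mult[OF Y powers_in_PH[OF xH]] f_powers_upto[OF xH])
    have IH: "f ?Y \<subseteq> pullback ` carrier H"
      by (rule less.hyps[OF card_Diff1_less[OF X(1) x(1)] Y])
    show ?thesis
    proof
      fix z assume z: "z \<in> f X"
      then have zK: "z \<in> carrier K" using f_closed[OF less.prems] by auto
      have "\<one>\<^bsub>K\<^esub> \<in> powers_upto K (pullback x) (H.ord x - 1)"
        using K.powers_upto_in_power_monoid[OF pullback_closed[OF xH]] by simp
      then have "z \<otimes>\<^bsub>K\<^esub> \<one>\<^bsub>K\<^esub> \<in> f ?Y <#>\<^bsub>K\<^esub> powers_upto K (pullback x) (H.ord x - 1)"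
        unfolding eq[symmetric] mem_set_mult using z by blast
      then obtain w i where w: "w \<in> f ?Y" "z = w \<otimes>\<^bsub>K\<^esub> pullback x [^]\<^bsub>K\<^esub> (i::nat)"
        using zK by (auto simp: mem_set_mult mem_powers_upto)
      then obtain u where u: "u \<in> carrier H" "w = pullback u" using IH by blast
      have "z = pullback (u \<otimes> x [^] i)"
        using w u xH by (simp add: pullback_mult pullback_pow)
      then show "z \<in> pullback ` carrier H" using u xH by blast
    qed
  qed
qed

lemma pullback_iso: "pullback \<in> iso H K"
proof (rule isoI)
  show "pullback \<in> hom H K"
    by (rule homI) (simp_all add: pullback_mult)
  show "bij_betw pullback (carrier H) (carrier K)"
  proof (rule bij_betw_imageI)
    show "inj_on pullback (carrier H)" by (rule inj_onI) (rule pullback_inj)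
    show "pullback ` carrier H = carrier K"
    proof
      show "carrier K \<subseteq> pullback ` carrier H"
      proof
        fix y assume "y \<in> carrier K"
        then have "{\<one>\<^bsub>K\<^esub>, y} \<in> PK" by simp
        then obtain X where "X \<in> PH" "f X = {\<one>\<^bsub>K\<^esub>, y}" using f_surj by blast
        then show "y \<in> pullback ` carrier H" using f_subset_range by blast
      qed
    qed auto
  qed
qed

end

lemma iso_of_power_monoid_iso:
  assumes "group H" "group K" "torsion_group H" "fin_power_monoid H \<cong> fin_power_monoid K"
  shows "H \<cong> K"
proof -
  obtain f where "f \<in> iso (fin_power_monoid H) (fin_power_monoid K)"
    using assms(4) by (auto simp: is_iso_def)
  then interpret torsion_power_monoid_iso H K f
    using assms torsion_group_ord_pos[OF assms(3)]
    by (simp add: torsion_power_monoid_iso_def torsion_power_monoid_iso_axioms_def)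
  show ?thesis using pullback_iso by (rule is_isoI)
qed

theorem corollary5p2:
  fixes H :: "('a, 'm) monoid_scheme" and K :: "('b, 'n) monoid_scheme"
  assumes "group H" and "group K"
    and "torsion_group H \<or> torsion_group K"
    and "fin_power_monoid H \<cong> fin_power_monoid K"
  shows "H \<cong> K"
  using assms(3)
proof
  assume "torsion_group H"
  then show ?thesis using assms iso_of_power_monoid_iso by blast
next
  assume "torsion_group K"
  moreover have "fin_power_monoid K \<cong> fin_power_monoid H"
    using assms(1,4) monoid_iso_sym monoid_fin_power_monoid group.is_monoid by blast
  ultimately have "K \<cong> H" using assms iso_of_power_monoid_iso by blast
  then show ?thesis using assms(2) group.iso_sym by blast
qed

end
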